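(* Let $\mathbb{K}=\mathbb{R}$ or $\mathbb{C}$, $\epsilon>0$ and $p_{1},p_{2}\in[2,\infty]$. There exists a positive integer $N$ (depending only on $\epsilon$) such that, whenever $n_1,n_2$ are positive integers with $\max\{n_{1},n_{2}\}>N$, there is a bilinear form $A\colon\ell_{p_{1}}^{n_{1}}\times\ell_{p_{2}}^{n_{2}}\to\mathbb{K}$ of the type \[ A(z^{(1)},z^{(2)})=\sum_{i=1}^{n_{1}}\sum_{j=1}^{n_{2}}\pm z_{i}^{(1)}z_{j}^{(2)} \] such that \[ \Vert A\Vert\leq(1+\epsilon)\max\left\{n_{2}^{1/p_{2}^{\ast}}n_{1}^{\max\{\frac{1}{2}-\frac{1}{p_{1}},0\}},\;n_{1}^{1/p_{1}^{\ast}}n_{2}^{\max\{\frac{1}{2}-\frac{1}{p_{2}},0\}}\right\}. \]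
   Context: $\ell_{p}^{n}$ denotes $\mathbb{K}^{n}$ with the $\ell_p$-norm; $1/\infty=0$; $p^{\ast}=p/(p-1)$ is the conjugate exponent (so $1/p^\ast=1-1/p$). "Of the type $\sum\pm\cdots$" means each coefficient of $z_i^{(1)}z_j^{(2)}$ lies in $\{-1,1\}$. The norm of a bilinear form is the supremum of $|A(x,y)|$ over $\Vert x\Vert_{p_1}\le1$, $\Vert y\Vert_{p_2}\le1$. *)

theory Defs
  imports "HOL-Analysis.Analysis"
begin

text \<open>
  The dimensions vary inside the statement, so K^n is represented by the sequences
  indexed by 1, ..., n and extended by 0.  Exponents are extended reals; in \<^typ>\<open>ereal\<close>
  one has 1 / \<open>\<infinity>\<close> = 0.
\<close>

definition coord_space :: "nat \<Rightarrow> (nat \<Rightarrow> 'a::real_normed_field) set" where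
  "coord_space n = {x. \<forall>i. i \<notin> {1..n} \<longrightarrow> x i = 0}"

text \<open>Only meant for n > 0 and exponents p with 1 \<open>\<le>\<close> p.\<close>

definition lp_norm :: "ereal \<Rightarrow> nat \<Rightarrow> (nat \<Rightarrow> 'a::real_normed_field) \<Rightarrow> real" where
  "lp_norm p n x =
     (if p = \<infinity> then Max ((\<lambda>i. norm (x i)) ` {1..n})
      else (\<Sum>i=1..n. norm (x i) powr real_of_ereal p) powr (1 / real_of_ereal p))"

definition lp_unit_ball :: "ereal \<Rightarrow> nat \<Rightarrow> (nat \<Rightarrow> 'a::real_normed_field) set" where
  "lp_unit_ball p n = {x \<in> coord_space n. lp_norm p n x \<le> 1}"

text \<open>The case split is needed because p / (p - 1) is not 1 in \<^typ>\<open>ereal\<close> for p = \<open>\<infinity>\<close>.\<close>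

definition conj_exponent :: "ereal \<Rightarrow> ereal" where
  "conj_exponent p = (if p = \<infinity> then 1 else p / (p - 1))"

definition recip_exponent :: "ereal \<Rightarrow> real" where
  "recip_exponent p = real_of_ereal (1 / p)"

definition signed_bilinear_form ::
  "nat \<Rightarrow> nat \<Rightarrow> ((nat \<Rightarrow> 'a::real_normed_field) \<Rightarrow> (nat \<Rightarrow> 'a) \<Rightarrow> 'a) \<Rightarrow> bool" where
  "signed_bilinear_form n1 n2 A \<longleftrightarrow>
     (\<exists>s. (\<forall>i\<in>{1..n1}. \<forall>j\<in>{1..n2}. s i j \<in> {-1, 1}) \<and>
          (\<forall>x\<in>coord_space n1. \<forall>y\<in>coord_space n2.
             A x y = (\<Sum>i=1..n1. \<Sum>j=1..n2. s i j * x i * y j)))"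

text \<open>The supremum is taken in \<^typ>\<open>ereal\<close>, so that it is meaningful without a boundedness proof.\<close>

definition bilinear_form_norm ::
  "ereal \<Rightarrow> ereal \<Rightarrow> nat \<Rightarrow> nat \<Rightarrow>
   ((nat \<Rightarrow> 'a::real_normed_field) \<Rightarrow> (nat \<Rightarrow> 'a) \<Rightarrow> 'a) \<Rightarrow> ereal" where
  "bilinear_form_norm p1 p2 n1 n2 A =
     (SUP (x, y) \<in> lp_unit_ball p1 n1 \<times> lp_unit_ball p2 n2. ereal (norm (A x y)))"

end

theory Submission
  imports Defs
begin

text \<open>
  The corner of size $n_1 \times n_2$ of a Hadamard matrix of order $m$ has norm at most
  $\sqrt{m}$ as a form on $\ell_2 \times \ell_2$, and comparing $\ell_2$ with $\ell_p$ costs a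
  factor $n^{1/2 - 1/p}$.  If $m$ is at most $(1 + \epsilon) \max\{n_1, n_2\}$, this is the claimed
  bound.  Such an $m$ exists for large $\max\{n_1, n_2\}$: Kronecker products of the Hadamard
  matrices of orders 2 and 12 have the orders $2^a 12^b$, and the ratios of consecutive numbers of
  this kind tend to 1 because $\log_2 12$ is irrational.
\<close>

section \<open>Hadamard matrices and their Kronecker products\<close>

text \<open>Counting from 0 lets \<open>div\<close> and \<open>mod\<close> index Kronecker products,
  and integer entries let order 12 be checked by evaluation.\<close>

definition hadamard :: "nat \<Rightarrow> (nat \<Rightarrow> nat \<Rightarrow> int) \<Rightarrow> bool" where
  "hadamard m H \<longleftrightarrow>
     (\<forall>i<m. \<forall>j<m. H i j \<in> {-1, 1}) \<and>
     (\<forall>i<m. \<forall>k<m. (\<Sum>j<m. H i j * H k j) = (if i = k then int m else 0))"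

lemma hadamard_1: "hadamard 1 (\<lambda>i j. 1)"
  by (simp add: hadamard_def)

lemma hadamard_2: "hadamard 2 (\<lambda>i j. if i = 1 \<and> j = 1 then -1 else 1)"
  by (auto simp: hadamard_def numeral_2_eq_2 less_Suc_eq)

text \<open>Paley's matrix: 1, 3, 4, 5, 9 are the nonzero squares modulo 11.\<close>

definition paley12 :: "nat \<Rightarrow> nat \<Rightarrow> int" where
  "paley12 i j =
     (if i = 0 then 1 else if j = 0 then -1
      else if (j + 11 - i) mod 11 \<in> {0, 1, 3, 4, 5, 9} then 1 else -1)"

lemma hadamard_12: "hadamard 12 paley12"
proof -
  \<comment> \<open>With lists as ranges, orthogonality becomes a finite computation.\<close>
  have "\<forall>i\<in>set [0..<12]. \<forall>k\<in>set [0..<12].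
      (\<Sum>j\<leftarrow>[0..<12]. paley12 i j * paley12 k j) = (if i = k then 12 else 0)"
    by code_simp
  then have "\<forall>i<12. \<forall>k<12. (\<Sum>j<12. paley12 i j * paley12 k j) = (if i = k then 12 else 0)"
    by (simp add: sum_list_distinct_conv_sum_set atLeast0LessThan del: upt_rec_numeral)
  then show ?thesis
    by (simp add: hadamard_def paley12_def)
qed

text \<open>Row \<open>i\<close> is the tensor product of row \<open>i div n\<close> of
  \<open>G\<close> and row \<open>i mod n\<close> of \<open>H\<close>, and inner products of tensor
  products factor.\<close>

lemma hadamard_kronecker:
  assumes G: "hadamard m G" and H: "hadamard n H"
  shows "hadamard (m * n) (\<lambda>i j. G (i div n) (j div n) * H (i mod n) (j mod n))"
proof (cases "n = 0")
  case False
  then have *: "i div n < m" "i mod n < n" if "i < m * n" for i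
    using that by (auto simp: less_mult_imp_div_less)
  have "(\<Sum>j<m * n. (G (i div n) (j div n) * H (i mod n) (j mod n)) *
          (G (k div n) (j div n) * H (k mod n) (j mod n))) = (if i = k then int (m * n) else 0)"
    if ik: "i < m * n" "k < m * n" for i k
  proof -
    have "(\<Sum>j<m * n. (G (i div n) (j div n) * H (i mod n) (j mod n)) *
          (G (k div n) (j div n) * H (k mod n) (j mod n))) =
        (\<Sum>a<m. \<Sum>b<n. (G (i div n) a * G (k div n) a) * (H (i mod n) b * H (k mod n) b))"
      unfolding sum_mult_product by (intro sum.cong refl) (simp add: mult_ac)
    also have "\<dots> = (\<Sum>a<m. G (i div n) a * G (k div n) a) * (\<Sum>b<n. H (i mod n) b * H (k mod n) b)"
      by (simp add: sum_product)
    also have "\<dots> = (if i div n = k div n then int m else 0) * (if i mod n = k mod n then int n else 0)"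
      using G H * ik by (simp add: hadamard_def)
    also have "\<dots> = (if i = k then int (m * n) else 0)"
    proof -
      have "i = k" if "i div n = k div n" "i mod n = k mod n"
        using that by (metis div_mult_mod_eq)
      then show ?thesis by auto
    qed
    finally show ?thesis .
  qed
  moreover have "G (i div n) (j div n) * H (i mod n) (j mod n) \<in> {-1, 1}"
    if "i < m * n" "j < m * n" for i j
  proof -
    have "G (i div n) (j div n) \<in> {-1, 1}" "H (i mod n) (j mod n) \<in> {-1, 1}"
      using G H * that by (auto simp: hadamard_def)
    then show ?thesis by auto
  qed
  ultimately show ?thesis by (simp add: hadamard_def)
qed (simp add: hadamard_def)

lemma hadamard_power:
  assumes "hadamard m H"
  shows "\<exists>G. hadamard (m ^ a) G"
proof (induction a)
  case 0
  show ?case using hadamard_1 by auto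
next
  case (Suc a)
  then show ?case using hadamard_kronecker[OF assms] by auto
qed

lemma hadamard_2_12: "\<exists>H. hadamard (2 ^ a * 12 ^ b) H"
  using hadamard_power[OF hadamard_2] hadamard_power[OF hadamard_12] hadamard_kronecker by meson

section \<open>Density of the orders on a logarithmic scale\<close>

text \<open>Cut the unit interval into finitely many cells. By Kronecker's approximation theorem
  each cell contains the fractional part of some natural multiple of \<theta>. Once x exceeds all
  these multiples, adding a natural number moves the right one to just above x.\<close>

lemma irrational_multiples_eventually_dense:
  fixes \<theta> \<delta> :: real
  assumes \<theta>: "\<theta> \<notin> \<rat>" "\<theta> > 0" and "\<delta> > 0"
  obtains K where "\<And>x. x \<ge> K \<Longrightarrow> \<exists>a b :: nat. x \<le> real a + real b * \<theta> \<and> real a + real b * \<theta> \<le> x + \<delta>"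
proof -
  \<comment> \<open>Cells have length 1/M. Rounding x up to the grid costs less than one cell, and
    the point found lies within the next one; hence the 2.\<close>
  obtain M :: nat where M: "M > 0" "2 / real M < \<delta>"
  proof -
    obtain M :: nat where "M > 0" "inverse (real M) < \<delta> / 2"
      using real_arch_inverse[of "\<delta> / 2"] \<open>\<delta> > 0\<close> by auto
    then show thesis using that[of M] by (simp add: field_simps)
  qed
  have "\<exists>k::nat. real i / M < frac (k * \<theta>) \<and> frac (k * \<theta>) < real (i + 1) / M" if "i < M" for i
  proof -
    \<comment> \<open>Midpoint and half the length of cell \<open>i\<close>.\<close>
    define c e where "c = (2 * real i + 1) / (2 * real M)" and "e = 1 / (2 * real M)"
    have c: "0 \<le> c" "c \<le> 1" "0 < e" using that by (simp_all add: c_def e_def)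
    obtain k :: nat where "\<bar>frac (k * \<theta>) - c\<bar> < e"
      using Kronecker_approx_1_explicit[OF \<theta>(1) c] by blast
    moreover have "c - e = real i / M" "c + e = real (i + 1) / M"
      using that by (simp_all add: c_def e_def field_simps)
    ultimately have "real i / M < frac (k * \<theta>) \<and> frac (k * \<theta>) < real (i + 1) / M"
      unfolding abs_less_iff by linarith
    then show ?thesis by blast
  qed
  then obtain k :: "nat \<Rightarrow> nat" where
    k: "\<And>i. i < M \<Longrightarrow> real i / M < frac (k i * \<theta>) \<and> frac (k i * \<theta>) < real (i + 1) / M"
    by metis
  \<comment> \<open>The sum dominates every \<open>k i * \<theta>\<close>; the 1 pays for passing
    from the grid point above x to its integer part \<open>q\<close>.\<close>
  define K where "K = (\<Sum>i<M. k i * \<theta>) + 1"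
  have "\<exists>a b :: nat. x \<le> real a + real b * \<theta> \<and> real a + real b * \<theta> \<le> x + \<delta>" if "x \<ge> K" for x
  proof -
    \<comment> \<open>\<open>j / M\<close> is the first grid point not below x; \<open>q\<close> is
      its integer part and \<open>i\<close> the cell that starts at its fractional part.\<close>
    define j where "j = \<lceil>x * M\<rceil>"
    define q where "q = j div int M"
    define i where "i = nat (j mod int M)"
    have i: "i < M" "j = q * int M + int i"
      using \<open>M > 0\<close> by (auto simp: i_def q_def nat_less_iff)
    then have qi: "q + real i / M = j / M"
      using \<open>M > 0\<close> by (simp add: field_simps)
    have j: "x \<le> j / M" "j / M < x + 1 / M"
      using \<open>M > 0\<close> unfolding j_def by (simp_all add: field_simps) linarith
    have "real i / M < 1" using i(1) by simp
    moreover have "k i * \<theta> \<le> (\<Sum>i<M. k i * \<theta>)"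
      using i(1) \<theta>(2) by (intro member_le_sum) auto
    ultimately have "k i * \<theta> \<le> q" using that j(1) qi unfolding K_def by linarith
    then have "\<lfloor>k i * \<theta>\<rfloor> \<le> q" by linarith
    \<comment> \<open>Since the floor is at most \<open>q\<close>, \<open>nat\<close> truncates
      nothing: the summand exchanges the integer part of \<open>k i * \<theta>\<close> for
      \<open>q\<close>.\<close>
    then have "real (nat (q - \<lfloor>k i * \<theta>\<rfloor>)) + k i * \<theta> = q + frac (k i * \<theta>)"
      by (simp add: frac_def)
    moreover have "real (i + 1) / M = real i / M + 1 / M" by (simp add: add_divide_distrib)
    moreover have "2 / real M = 1 / M + 1 / M" by simp
    ultimately show ?thesis using k[OF i(1)] qi j M(2)
      by (intro exI[of _ "nat (q - \<lfloor>k i * \<theta>\<rfloor>)"] exI[of _ "k i"]) linarith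
  qed
  then show thesis using that by blast
qed

text \<open>A fraction h/k would give 12^k = 2^h with k > 0, but 3 divides only the left
  side.\<close>

lemma log_2_12_irrational: "log 2 12 \<notin> \<rat>"
proof
  assume "log 2 12 \<in> \<rat>"
  then obtain h k where hk: "k \<noteq> 0" "\<bar>log 2 12\<bar> = real h / real k"
    by (rule Rats_abs_nat_div_natE)
  then have "log 2 (12 ^ k) = log 2 (2 ^ h)"
    by (simp add: log_nat_power field_simps)
  then have "(12::real) ^ k = 2 ^ h" using inj_onD[OF log_inj[of 2]] by simp
  then have "real (12 ^ k) = real (2 ^ h)" by simp
  then have "(12::nat) ^ k = 2 ^ h" by (simp only: of_nat_eq_iff)
  moreover have "(3::nat) dvd 12 ^ k" using hk(1) by (simp add: dvd_power_iff dvd_trans[OF _ dvd_power])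
  ultimately have "(3::nat) dvd 2 ^ h" by simp
  then have "(3::nat) dvd 2" by (rule prime_dvd_power[rotated]) simp
  then show False by simp
qed

text \<open>Logarithms to base 2 turn the orders 2^a 12^b into a + b log 12 and the factor 1 +
  \<epsilon> into a window of fixed length.\<close>

lemma hadamard_orders_dense:
  fixes \<epsilon> :: real
  assumes "\<epsilon> > 0"
  obtains N where "\<And>n. n > N \<Longrightarrow> \<exists>m H. hadamard m H \<and> n \<le> m \<and> real m \<le> (1 + \<epsilon>) * real n"
proof -
  obtain K where K: "\<And>x. x \<ge> K \<Longrightarrow>
      \<exists>a b :: nat. x \<le> real a + real b * log 2 12 \<and> real a + real b * log 2 12 \<le> x + log 2 (1 + \<epsilon>)"
    using irrational_multiples_eventually_dense[OF log_2_12_irrational, of "log 2 (1 + \<epsilon>)"] assms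
    by auto
  have "\<exists>m H. hadamard m H \<and> n \<le> m \<and> real m \<le> (1 + \<epsilon>) * real n" if n: "n > nat \<lceil>2 powr K\<rceil>" for n
  proof -
    have n': "real n \<ge> 2 powr K" "n > 0" using n by linarith+
    then have "log 2 n \<ge> K" by (simp add: le_log_iff)
    then obtain a b :: nat where ab: "log 2 n \<le> real a + real b * log 2 12"
        "real a + real b * log 2 12 \<le> log 2 n + log 2 (1 + \<epsilon>)"
      using K by blast
    define m :: nat where "m = 2 ^ a * 12 ^ b"
    have "m > 0" "log 2 m = real a + real b * log 2 12"
      by (simp_all add: m_def log_mult log_nat_power)
    moreover have "log 2 ((1 + \<epsilon>) * n) = log 2 n + log 2 (1 + \<epsilon>)"
      using assms n' by (simp add: log_mult)
    ultimately have "log 2 n \<le> log 2 m" "log 2 m \<le> log 2 ((1 + \<epsilon>) * n)"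
      using ab by simp_all
    then have "n \<le> m" "m \<le> (1 + \<epsilon>) * n"
      using assms \<open>m > 0\<close> \<open>n > 0\<close> by (simp_all del: log_mult)
    then show ?thesis using hadamard_2_12 unfolding m_def by blast
  qed
  then show thesis using that by blast
qed

section \<open>The norm of a corner on Euclidean spaces\<close>

text \<open>For fixed x the form is linear in y with coefficients \<open>w j\<close>. Orthogonality
  of the rows kills the cross terms, so over all of \<open>J\<close> the squared norms of the
  \<open>w j\<close> sum to c times that of x; Cauchy-Schwarz then brings in y. The sort covers
  \<open>real\<close> and \<open>complex\<close> at once, with the real inner product on
  both.\<close>

lemma norm_bilinear_orthogonal_rows_le:
  fixes x :: "'i \<Rightarrow> 'a::{real_normed_field, real_inner}" and y :: "'j \<Rightarrow> 'a"
  assumes orth: "\<And>i k. i \<in> I \<Longrightarrow> k \<in> I \<Longrightarrow> (\<Sum>j\<in>J. s i j * s k j) = (if i = k then c else 0)"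
    and fin: "finite I" "finite J" and J': "J' \<subseteq> J" and "c \<ge> 0"
  shows "norm (\<Sum>i\<in>I. \<Sum>j\<in>J'. of_real (s i j) * x i * y j) \<le>
    sqrt c * L2_set (\<lambda>i. norm (x i)) I * L2_set (\<lambda>j. norm (y j)) J'"
proof -
  define w where "w j = (\<Sum>i\<in>I. s i j *\<^sub>R x i)" for j
  have "(\<Sum>j\<in>J. (norm (w j))\<^sup>2) = (\<Sum>j\<in>J. \<Sum>i\<in>I. \<Sum>k\<in>I. (s i j * s k j) * (x k \<bullet> x i))"
    unfolding w_def power2_norm_eq_inner inner_sum_left inner_sum_right
    by (simp add: mult.assoc)
  also have "\<dots> = (\<Sum>i\<in>I. \<Sum>k\<in>I. \<Sum>j\<in>J. (s i j * s k j) * (x k \<bullet> x i))"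
    by (subst sum.swap) (intro sum.cong refl sum.swap)
  also have "\<dots> = (\<Sum>i\<in>I. \<Sum>k\<in>I. (if i = k then c else 0) * (x k \<bullet> x i))"
    by (simp add: sum_distrib_right[symmetric] orth)
  also have "\<dots> = c * (\<Sum>i\<in>I. (norm (x i))\<^sup>2)"
    using fin by (simp add: if_distrib[of "\<lambda>z. z * _"] sum.delta sum_distrib_left power2_norm_eq_inner
        cong: if_cong)
  \<comment> \<open>Passing to the columns in \<open>J'\<close> only drops nonnegative
    terms.\<close>
  finally have "(\<Sum>j\<in>J'. (norm (w j))\<^sup>2) \<le> c * (\<Sum>i\<in>I. (norm (x i))\<^sup>2)"
    using sum_mono2[OF fin(2) J', of "\<lambda>j. (norm (w j))\<^sup>2"] by simp
  then have w: "L2_set (\<lambda>j. norm (w j)) J' \<le> sqrt c * L2_set (\<lambda>i. norm (x i)) I"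
    unfolding L2_set_def by (simp flip: real_sqrt_mult)
  have "(\<Sum>i\<in>I. \<Sum>j\<in>J'. of_real (s i j) * x i * y j) = (\<Sum>j\<in>J'. w j * y j)"
    by (subst sum.swap) (simp add: w_def sum_distrib_right scaleR_conv_of_real)
  also have "norm \<dots> \<le> (\<Sum>j\<in>J'. \<bar>norm (w j)\<bar> * \<bar>norm (y j)\<bar>)"
    by (rule order_trans[OF norm_sum]) (simp add: norm_mult)
  also have "\<dots> \<le> L2_set (\<lambda>j. norm (w j)) J' * L2_set (\<lambda>j. norm (y j)) J'"
    by (rule L2_set_mult_ineq)
  also have "\<dots> \<le> sqrt c * L2_set (\<lambda>i. norm (x i)) I * L2_set (\<lambda>j. norm (y j)) J'"
    by (intro mult_right_mono w L2_set_nonneg)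
  finally show ?thesis .
qed

section \<open>Exponents and the comparison of norms\<close>

lemma recip_exponent_ereal [simp]: "r \<noteq> 0 \<Longrightarrow> recip_exponent (ereal r) = 1 / r"
  by (simp add: recip_exponent_def one_ereal_def)

lemma recip_exponent_infty [simp]: "recip_exponent \<infinity> = 0"
  by (simp add: recip_exponent_def)

lemma recip_exponent_le_half: "2 \<le> p \<Longrightarrow> recip_exponent p \<le> 1 / 2"
  by (cases p) (auto simp: divide_simps)

lemma recip_exponent_conj_exponent:
  assumes "2 \<le> p"
  shows "recip_exponent (conj_exponent p) = 1 - recip_exponent p"
proof (cases p)
  case (real r)
  with assms have r: "r \<ge> 2" by simp
  then have "conj_exponent p = ereal (r / (r - 1))"
    by (simp add: conj_exponent_def real one_ereal_def)
  then show ?thesis using r real by (simp add: field_simps)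
qed (use assms in \<open>auto simp: conj_exponent_def one_ereal_def\<close>)

text \<open>For finite p this is Hoelder's inequality against the constant vector 1, obtained by
  summing Young's inequality over the coordinates.\<close>

lemma L2_set_le_if_lp_norm_le_1:
  assumes p: "2 \<le> p" and "n > 0" and x: "lp_norm p n x \<le> 1"
  shows "L2_set (\<lambda>i. norm (x i)) {1..n} \<le> real n powr (1 / 2 - recip_exponent p)"
proof (cases p)
  case PInf
  have "norm (x i) \<le> 1" if "i \<in> {1..n}" for i
    using x that PInf by (auto simp: lp_norm_def)
  then have "(\<Sum>i=1..n. (norm (x i))\<^sup>2) \<le> (\<Sum>i=1..n. 1)"
    by (intro sum_mono) (auto simp: power_le_one)
  then show ?thesis using PInf by (simp add: L2_set_def powr_half_sqrt)
next
  case (real r)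
  with p have r: "r \<ge> 2" by simp
  define S where "S = (\<Sum>i=1..n. norm (x i) powr r)"
  have "S \<ge> 0" unfolding S_def by (intro sum_nonneg) auto
  have "S powr (1 / r) \<le> 1"
    using x real by (simp add: lp_norm_def S_def)
  have "S \<le> 1"
  proof (rule ccontr)
    assume "\<not> S \<le> 1"
    then have "S powr (1 / r) > 1" using r by (intro gr_one_powr) auto
    with \<open>S powr (1 / r) \<le> 1\<close> show False by simp
  qed
  \<comment> \<open>Young's inequality with weights 2/r and 1 - 2/r for
    \<open>n * norm (x i) powr r\<close> and 1. The factor n makes both arguments equal for the
    extremal vector, whose entries all satisfy |x i|^r = 1/n.\<close>
  have young: "real n powr (2 / r) * (norm (x i))\<^sup>2 \<le> 2 / r * (n * norm (x i) powr r) + (1 - 2 / r)" for i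
  proof (cases "x i = 0")
    case False
    then have "(n * norm (x i) powr r) powr (2 / r) = real n powr (2 / r) * (norm (x i))\<^sup>2"
      using r by (simp add: powr_mult powr_powr powr_numeral)
    then show ?thesis
      using Youngs_inequality_0[of "2 / r" "1 - 2 / r" "n * norm (x i) powr r" 1] r False \<open>n > 0\<close>
      by simp
  qed (use r in simp)
  have "real n powr (2 / r) * (\<Sum>i=1..n. (norm (x i))\<^sup>2) \<le>
      (\<Sum>i=1..n. 2 / r * (n * norm (x i) powr r) + (1 - 2 / r))"
    unfolding sum_distrib_left by (intro sum_mono young)
  also have "\<dots> = 2 / r * (n * S) + n * (1 - 2 / r)"
    by (simp add: sum.distrib S_def sum_distrib_left)
  also have "\<dots> \<le> 2 / r * (n * 1) + n * (1 - 2 / r)"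
    using \<open>S \<le> 1\<close> r by (intro add_right_mono mult_left_mono) (simp_all add: mult_left_le)
  \<comment> \<open>The sum has collapsed to n, written as a product so that
    \<open>real n powr (2 / r)\<close> cancels.\<close>
  also have "\<dots> = real n powr (2 / r) * real n powr (1 - 2 / r)"
    using \<open>n > 0\<close> by (simp add: algebra_simps flip: powr_add)
  finally have "(\<Sum>i=1..n. (norm (x i))\<^sup>2) \<le> real n powr (1 - 2 / r)"
    using \<open>n > 0\<close> by simp
  then have "L2_set (\<lambda>i. norm (x i)) {1..n} \<le> sqrt (real n powr (1 - 2 / r))"
    by (simp add: L2_set_def)
  also have "\<dots> = real n powr (1 / 2 - 1 / r)"
    by (simp add: powr_half_sqrt[symmetric] powr_powr field_simps)
  finally show ?thesis using real r by simp
qed (use p in simp)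

section \<open>The form given by a corner of a Hadamard matrix\<close>

text \<open>The square root of the larger dimension merges with that dimension's power 1/2 - 1/p
  into the power 1 - 1/p, which is the reciprocal of the conjugate exponent.\<close>

lemma exists_signed_bilinear_form:
  fixes \<epsilon> :: real
  assumes "\<epsilon> > 0" and H: "hadamard m H" and m: "max n1 n2 \<le> m" "real m \<le> (1 + \<epsilon>) * max n1 n2"
    and p: "2 \<le> p1" "2 \<le> p2" and n: "n1 > 0" "n2 > 0"
  shows "\<exists>A :: (nat \<Rightarrow> 'a) \<Rightarrow> (nat \<Rightarrow> 'a) \<Rightarrow> 'a::{real_normed_field, real_inner}.
      signed_bilinear_form n1 n2 A \<and>
      bilinear_form_norm p1 p2 n1 n2 A \<le> ereal ((1 + \<epsilon>) * max
        (real n2 powr recip_exponent (conj_exponent p2) *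
           real n1 powr max (1 / 2 - recip_exponent p1) 0)
        (real n1 powr recip_exponent (conj_exponent p1) *
           real n2 powr max (1 / 2 - recip_exponent p2) 0))"
proof -
  \<comment> \<open>Coordinates count from 1, matrix indices from 0.\<close>
  define s :: "nat \<Rightarrow> nat \<Rightarrow> real" where "s i j = of_int (H (i - 1) (j - 1))" for i j
  define A :: "(nat \<Rightarrow> 'a) \<Rightarrow> (nat \<Rightarrow> 'a) \<Rightarrow> 'a"
    where "A x y = (\<Sum>i=1..n1. \<Sum>j=1..n2. of_real (s i j) * x i * y j)" for x y
  define r1 r2 where "r1 = recip_exponent p1" and "r2 = recip_exponent p2"
  \<comment> \<open>The target maximum, simplified by 1/p* = 1 - 1/p and by 1/2 - 1/p being
    nonnegative for p at least 2.\<close>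
  define B where "B = max (real n2 powr (1 - r2) * real n1 powr (1 / 2 - r1))
                          (real n1 powr (1 - r1) * real n2 powr (1 / 2 - r2))"
  \<comment> \<open>The sum runs over full rows of length m, since truncated rows need not be
    orthogonal.\<close>
  have orth: "(\<Sum>j\<in>{1..m}. s i j * s k j) = (if i = k then real m else 0)"
    if "i \<in> {1..n1}" "k \<in> {1..n1}" for i k
  proof -
    have "(\<Sum>j\<in>{1..m}. s i j * s k j) = of_int (\<Sum>j<m. H (i - 1) j * H (k - 1) j)"
      by (simp add: s_def sum.atLeast1_atMost_eq)
    also have "\<dots> = of_int (if i - 1 = k - 1 then int m else 0)"
      using H that m(1) by (subst H[unfolded hadamard_def, THEN conjunct2, rule_format]) auto
    finally show ?thesis using that by (auto split: if_splits)
  qed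
  have "signed_bilinear_form n1 n2 A"
    unfolding signed_bilinear_form_def
  proof (intro exI[of _ "\<lambda>i j. of_real (s i j)"] conjI ballI)
    fix i j assume "i \<in> {1..n1}" "j \<in> {1..n2}"
    then have "i - 1 < m" "j - 1 < m" using m(1) by auto
    then have "H (i - 1) (j - 1) \<in> {-1, 1}" using H unfolding hadamard_def by blast
    then show "(of_real (s i j) :: 'a) \<in> {-1, 1}" by (auto simp: s_def)
  qed (simp add: A_def)
  moreover have "norm (A x y) \<le> (1 + \<epsilon>) * B"
    if x: "x \<in> lp_unit_ball p1 n1" and y: "y \<in> lp_unit_ball p2 n2" for x y
  proof -
    have "norm (A x y) \<le> sqrt m * L2_set (\<lambda>i. norm (x i)) {1..n1} * L2_set (\<lambda>j. norm (y j)) {1..n2}"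
      unfolding A_def using m(1) by (intro norm_bilinear_orthogonal_rows_le[OF orth]) auto
    also have "\<dots> \<le> sqrt m * real n1 powr (1 / 2 - r1) * real n2 powr (1 / 2 - r2)"
      using x y p n unfolding r1_def r2_def
      by (intro mult_mono L2_set_le_if_lp_norm_le_1 mult_nonneg_nonneg L2_set_nonneg)
         (auto simp: lp_unit_ball_def)
    \<comment> \<open>The hypothesis on m gives the factor sqrt(1 + \<epsilon>), which is at most 1
      + \<epsilon>.\<close>
    also have "sqrt m \<le> (1 + \<epsilon>) * sqrt (max n1 n2)"
    proof (rule real_le_lsqrt)
      have "(1 + \<epsilon>) * 1 * max n1 n2 \<le> (1 + \<epsilon>) * (1 + \<epsilon>) * max n1 n2"
        using assms(1) by (intro mult_right_mono mult_left_mono) auto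
      with m(2) show "real m \<le> ((1 + \<epsilon>) * sqrt (max n1 n2))\<^sup>2"
        by (simp add: power_mult_distrib) (simp add: power2_eq_square)
    qed (use assms(1) in auto)
    also have "(1 + \<epsilon>) * sqrt (max n1 n2) * real n1 powr (1 / 2 - r1) * real n2 powr (1 / 2 - r2)
      = (1 + \<epsilon>) * (sqrt (max n1 n2) * real n1 powr (1 / 2 - r1) * real n2 powr (1 / 2 - r2))"
      by simp
    also have "sqrt (max n1 n2) * real n1 powr (1 / 2 - r1) * real n2 powr (1 / 2 - r2) \<le> B"
    \<comment> \<open>The larger dimension decides which entry of the maximum \<open>B\<close>
      equals the left side.\<close>
    proof (cases "n1 \<le> n2")
      case True
      have "real n2 powr (1 - r2) = sqrt n2 * real n2 powr (1 / 2 - r2)"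
        by (simp add: powr_half_sqrt[symmetric] flip: powr_add)
      then show ?thesis using True by (simp add: B_def max_def mult_ac)
    next
      case False
      have "real n1 powr (1 - r1) = sqrt n1 * real n1 powr (1 / 2 - r1)"
        by (simp add: powr_half_sqrt[symmetric] flip: powr_add)
      then show ?thesis using False by (simp add: B_def max_def mult_ac)
    qed
    \<comment> \<open>The links that estimate only a factor leave monotonicity conditions,
      discharged here.\<close>
    finally show ?thesis using assms(1) by (simp add: mult_right_mono)
  qed
  then have "bilinear_form_norm p1 p2 n1 n2 A \<le> ereal ((1 + \<epsilon>) * B)"
    unfolding bilinear_form_norm_def by (intro SUP_least) auto
  moreover have "max (1 / 2 - recip_exponent p1) 0 = 1 / 2 - r1"
    "max (1 / 2 - recip_exponent p2) 0 = 1 / 2 - r2"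
    using p recip_exponent_le_half by (auto simp: r1_def r2_def)
  ultimately show ?thesis
    unfolding B_def r1_def r2_def using p by (auto simp: recip_exponent_conj_exponent)
qed

theorem theorem3p3:
  fixes \<epsilon> :: real
  assumes "\<epsilon> > 0"
  shows "\<exists>N::nat. N > 0 \<and>
    (\<forall>(p1::ereal) (p2::ereal) (n1::nat) (n2::nat).
       2 \<le> p1 \<longrightarrow> 2 \<le> p2 \<longrightarrow> n1 > 0 \<longrightarrow> n2 > 0 \<longrightarrow> max n1 n2 > N \<longrightarrow>
       (\<exists>A :: (nat \<Rightarrow> real) \<Rightarrow> (nat \<Rightarrow> real) \<Rightarrow> real.
          signed_bilinear_form n1 n2 A \<and>
          bilinear_form_norm p1 p2 n1 n2 A \<le> ereal ((1 + \<epsilon>) * max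
            (real n2 powr recip_exponent (conj_exponent p2) *
               real n1 powr max (1 / 2 - recip_exponent p1) 0)
            (real n1 powr recip_exponent (conj_exponent p1) *
               real n2 powr max (1 / 2 - recip_exponent p2) 0))) \<and>
       (\<exists>A :: (nat \<Rightarrow> complex) \<Rightarrow> (nat \<Rightarrow> complex) \<Rightarrow> complex.
          signed_bilinear_form n1 n2 A \<and>
          bilinear_form_norm p1 p2 n1 n2 A \<le> ereal ((1 + \<epsilon>) * max
            (real n2 powr recip_exponent (conj_exponent p2) *
               real n1 powr max (1 / 2 - recip_exponent p1) 0)
            (real n1 powr recip_exponent (conj_exponent p1) *
               real n2 powr max (1 / 2 - recip_exponent p2) 0))))"
proof -
  \<comment> \<open>Chosen before exponents, dimensions and scalar field, so it depends on
    \<epsilon> alone.\<close>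
  obtain N where N: "\<And>n. n > N \<Longrightarrow> \<exists>m H. hadamard m H \<and> n \<le> m \<and> real m \<le> (1 + \<epsilon>) * real n"
    using hadamard_orders_dense[OF assms] by blast
  \<comment> \<open>\<open>Suc N\<close> ensures positivity, as \<open>N\<close> may be 0.\<close>
  show ?thesis
  proof (intro exI[of _ "Suc N"] conjI[OF zero_less_Suc] allI impI)
    fix p1 p2 :: ereal and n1 n2 :: nat
    assume *: "2 \<le> p1" "2 \<le> p2" "n1 > 0" "n2 > 0" and "max n1 n2 > Suc N"
    then obtain m H where "hadamard m H" "max n1 n2 \<le> m" "real m \<le> (1 + \<epsilon>) * max n1 n2"
      using N[of "max n1 n2"] by auto
    \<comment> \<open>Still polymorphic in the scalars, so it serves both fields.\<close>
    note form = exists_signed_bilinear_form[OF assms this *]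
    let ?bound = "ereal ((1 + \<epsilon>) * max
        (real n2 powr recip_exponent (conj_exponent p2) *
           real n1 powr max (1 / 2 - recip_exponent p1) 0)
        (real n1 powr recip_exponent (conj_exponent p1) *
           real n2 powr max (1 / 2 - recip_exponent p2) 0))"
    show "(\<exists>A :: (nat \<Rightarrow> real) \<Rightarrow> (nat \<Rightarrow> real) \<Rightarrow> real.
          signed_bilinear_form n1 n2 A \<and> bilinear_form_norm p1 p2 n1 n2 A \<le> ?bound) \<and>
        (\<exists>A :: (nat \<Rightarrow> complex) \<Rightarrow> (nat \<Rightarrow> complex) \<Rightarrow> complex.
          signed_bilinear_form n1 n2 A \<and> bilinear_form_norm p1 p2 n1 n2 A \<le> ?bound)"
      by (intro conjI form)
  qed
qed

end
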